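(* Let $G=(V,E)$ be an undirected graph (multiple edges allowed, no loops), let $X\subseteq V$, and suppose that $d_G(x)\ge\omega$ for every $x\in X$. Then $E$ has an $\omega$-good coloring over $X$, i.e. there is a map $c:E\to\omega$ such that for every $x\in X$ and every $k<\omega$ some edge incident to $x$ has color $k$.
   Context: $d_G(x)$ is the degree of $x$, counting multiple edges with multiplicity. *)

theory Defs
  imports Main
begin

unbundle cardinal_syntax

text \<open>
  Undirected graphs of arbitrary cardinality. Edges are objects of their own, and \<open>ends\<close>
  sends an edge to the set of its two endvertices, so distinct edges may be parallel;
  the cardinality condition excludes loops.
\<close>

locale multigraph =
  fixes V :: "'v set" and E :: "'e set" and ends :: "'e \<Rightarrow> 'v set"
  assumes ends_in_vertices: "e \<in> E \<Longrightarrow> ends e \<subseteq> V"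
    and two_ends: "e \<in> E \<Longrightarrow> card (ends e) = 2"

definition incident_edges :: "'e set \<Rightarrow> ('e \<Rightarrow> 'v set) \<Rightarrow> 'v \<Rightarrow> 'e set" where
  "incident_edges E ends x = {e \<in> E. x \<in> ends e}"

text \<open>
  The degree is a cardinal, represented as in the library by a cardinal order; parallel edges
  are different elements of \<open>E\<close>, hence counted with multiplicity.
\<close>

definition degree :: "'e set \<Rightarrow> ('e \<Rightarrow> 'v set) \<Rightarrow> 'v \<Rightarrow> 'e rel" where
  "degree E ends x = |incident_edges E ends x|"

text \<open>
  The set of colors \<open>\<omega>\<close> is the type of natural numbers. A coloring is a total function on the
  edge type, of which only the values on \<open>E\<close> matter.
\<close>

definition omega_good_coloring ::
    "'e set \<Rightarrow> ('e \<Rightarrow> 'v set) \<Rightarrow> 'v set \<Rightarrow> ('e \<Rightarrow> nat) \<Rightarrow> bool" where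
  "omega_good_coloring E ends X c \<longleftrightarrow>
     (\<forall>x\<in>X. \<forall>k. \<exists>e\<in>incident_edges E ends x. c e = k)"

end

theory Submission
  imports Defs "HOL-Library.Countable_Set"
begin

text \<open>
  It suffices to choose distinct edges \<open>f (x, k)\<close> incident to \<open>x\<close>, for \<open>x \<in> X\<close> and all colors \<open>k\<close>,
  and to give \<open>f (x, k)\<close> the color \<open>k\<close>. Shrink every set of candidates to a countably infinite one.
  Since an edge has only two ends, each request \<open>(x, k)\<close> then competes with only countably many
  others, so the components of the conflict relation are countable, and requests in different
  components never compete. Inside a countable component the edges can be chosen greedily.
\<close>

lemma countable_distinct_representatives:
  fixes A :: "'i \<Rightarrow> 'a set"
  assumes "countable I" and inf: "\<And>i. i \<in> I \<Longrightarrow> infinite (A i)"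
  shows "\<exists>f. inj_on f I \<and> (\<forall>i\<in>I. f i \<in> A i)"
proof -
  obtain g :: "'i \<Rightarrow> nat" where g: "inj_on g I"
    using \<open>countable I\<close> by (auto simp: countable_def)
  define B where "B n = (if n \<in> g ` I then A (inv_into I g n) else undefined)" for n
  have B: "B (g i) = A i" if "i \<in> I" for i
    using that g by (simp add: B_def)
  have "\<exists>h. \<forall>n. n \<in> g ` I \<longrightarrow> h n \<in> B n - h ` {..<n}"
  proof (rule dependent_wellorder_choice)
    fix r :: 'a and f g' :: "nat \<Rightarrow> 'a" and n :: nat
    assume "\<And>m. m < n \<Longrightarrow> f m = g' m"
    then have "f ` {..<n} = g' ` {..<n}"
      by (intro image_cong) auto
    then show "(n \<in> g ` I \<longrightarrow> r \<in> B n - f ` {..<n}) = (n \<in> g ` I \<longrightarrow> r \<in> B n - g' ` {..<n})"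
      by simp
  next
    fix n :: nat and f :: "nat \<Rightarrow> 'a"
    show "\<exists>r. n \<in> g ` I \<longrightarrow> r \<in> B n - f ` {..<n}"
    proof (cases "n \<in> g ` I")
      case True
      then have "infinite (B n)" using inf B by auto
      then have "infinite (B n - f ` {..<n})" by (simp add: Diff_infinite_finite)
      then show ?thesis using infinite_imp_nonempty by blast
    qed auto
  qed
  then obtain h where h: "h n \<in> B n - h ` {..<n}" if "n \<in> g ` I" for n
    by blast
  have "inj_on h (g ` I)"
    by (rule linorder_inj_onI') (metis h DiffD2 imageI lessThan_iff)
  then have "inj_on (h \<circ> g) I"
    using g by (rule comp_inj_on[rotated])
  moreover have "(h \<circ> g) i \<in> A i" if "i \<in> I" for i
    using h[of "g i"] B that by auto
  ultimately show ?thesis by blast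
qed

text \<open>For each \<open>n\<close>, the points reached in exactly \<open>n\<close> steps form a
  countable set, by induction; the closure is the union of these sets over all \<open>n\<close>.
  This makes the components of the conflict relation countable.\<close>

lemma countable_rtrancl_Image:
  assumes "\<And>x. countable (R `` {x})"
  shows "countable (R\<^sup>* `` {x})"
proof -
  have "countable ((R ^^ n) `` {x})" for n
  proof (induction n)
    case (Suc n)
    have "(R ^^ Suc n) `` {x} = (\<Union>y\<in>(R ^^ n) `` {x}. R `` {y})" by auto
    then show ?case using Suc assms by simp
  qed simp
  moreover have "R\<^sup>* `` {x} = (\<Union>n. (R ^^ n) `` {x})"
    by (auto simp: rtrancl_power)
  ultimately show ?thesis by simp
qed

lemma distinct_representatives:
  fixes A :: "'i \<Rightarrow> 'a set"
  assumes inf: "\<And>i. i \<in> I \<Longrightarrow> infinite (A i)"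
    and cnt: "\<And>a. countable {i \<in> I. a \<in> A i}"
  shows "\<exists>f. inj_on f I \<and> (\<forall>i\<in>I. f i \<in> A i)"
proof -
  have "\<exists>N. N \<subseteq> A i \<and> infinite N \<and> countable N" if "i \<in> I" for i
    using infinite_countable_subset'[OF inf[OF that]] by blast
  then obtain N where N: "N i \<subseteq> A i" "infinite (N i)" "countable (N i)" if "i \<in> I" for i
    by metis
  define R where "R = {(i, j). i \<in> I \<and> j \<in> I \<and> N i \<inter> N j \<noteq> {}}"
  have "countable (R `` {i})" for i
  proof (cases "i \<in> I")
    case True
    \<comment> \<open>Here the shrinking pays off: the union runs over the countable set
      \<open>N i\<close>, whereas \<open>A i\<close> may be uncountable.\<close>
    have "R `` {i} \<subseteq> (\<Union>a\<in>N i. {j \<in> I. a \<in> A j})"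
      using N(1) by (auto simp: R_def)
    then show ?thesis
      using N(3)[OF True] cnt by (rule countable_subset[OF _ countable_UN])
  qed (auto simp: R_def)
  \<comment> \<open>For \<open>i\<close> outside \<open>I\<close> the reflexive closure still
    contains \<open>i\<close>, where nothing is known about \<open>N\<close>; the intersection
    removes it.\<close>
  then have "countable (R\<^sup>* `` {i} \<inter> I)" for i
    by (intro countable_Int1 countable_rtrancl_Image)
  then have "\<exists>f. inj_on f (R\<^sup>* `` {i} \<inter> I) \<and> (\<forall>j\<in>R\<^sup>* `` {i} \<inter> I. f j \<in> N j)" for i
    using N(2) by (intro countable_distinct_representatives) auto
  \<comment> \<open>The choice is indexed by the component as a set, not by \<open>i\<close>, so
    that all indices of one component share the same injection.\<close>
  then have "\<forall>C\<in>range (\<lambda>i. R\<^sup>* `` {i} \<inter> I). \<exists>f. inj_on f C \<and> (\<forall>j\<in>C. f j \<in> N j)"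
    by blast
  then obtain F where "\<forall>C\<in>range (\<lambda>i. R\<^sup>* `` {i} \<inter> I). inj_on (F C) C \<and> (\<forall>j\<in>C. F C j \<in> N j)"
    by metis
  then have F: "inj_on (F (R\<^sup>* `` {i} \<inter> I)) (R\<^sup>* `` {i} \<inter> I)"
    "j \<in> R\<^sup>* `` {i} \<inter> I \<Longrightarrow> F (R\<^sup>* `` {i} \<inter> I) j \<in> N j" for i j
    by blast+
  define f where "f i = F (R\<^sup>* `` {i} \<inter> I) i" for i
  have f: "f i \<in> N i" if "i \<in> I" for i
    using F(2)[of i i] that by (simp add: f_def)
  have "inj_on f I"
  proof (rule inj_onI)
    fix i j assume ij: "i \<in> I" "j \<in> I" and eq: "f i = f j"
    \<comment> \<open>The common value lies in \<open>N i \<inter> N j\<close>, so a collision can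
      only occur within one component.\<close>
    then have R: "(i, j) \<in> R" "(j, i) \<in> R"
      using f[of i] f[of j] by (auto simp: R_def)
    then have "R\<^sup>* `` {i} = R\<^sup>* `` {j}"
      by (auto intro: converse_rtrancl_into_rtrancl)
    then have "F (R\<^sup>* `` {i} \<inter> I) i = F (R\<^sup>* `` {i} \<inter> I) j"
      using eq by (simp add: f_def)
    then show "i = j"
      using F(1)[of i] R ij by (auto dest: inj_onD)
  qed
  then show ?thesis using f N(1) by blast
qed

theorem theorem4p3:
  fixes V :: "'v set" and E :: "'e set" and ends :: "'e \<Rightarrow> 'v set" and X :: "'v set"
  assumes "multigraph V E ends"
    and "X \<subseteq> V"
    and "\<And>x. x \<in> X \<Longrightarrow> natLeq \<le>o degree E ends x"
  shows "\<exists>c :: 'e \<Rightarrow> nat. omega_good_coloring E ends X c"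
proof -
  interpret multigraph V E ends by fact
  let ?I = "X \<times> (UNIV :: nat set)"
  let ?A = "\<lambda>p. incident_edges E ends (fst p)"
  have "infinite (?A p)" if "p \<in> ?I" for p
    using assms(3)[of "fst p"] that
    by (metis degree_def infinite_iff_natLeq_ordLeq mem_Times_iff)
  moreover have "countable {p \<in> ?I. e \<in> ?A p}" for e
  proof (cases "e \<in> E")
    case True
    then have "finite (ends e)"
      using two_ends by (metis card.infinite zero_neq_numeral)
    moreover have "{p \<in> ?I. e \<in> ?A p} \<subseteq> ends e \<times> UNIV"
      by (auto simp: incident_edges_def)
    ultimately show ?thesis
      by (meson countable_SIGMA countable_finite countable_subset countableI_type)
  qed (auto simp: incident_edges_def)
  ultimately obtain f where f: "inj_on f ?I" "\<forall>p\<in>?I. f p \<in> ?A p"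
    using distinct_representatives[of ?I ?A] by blast
  \<comment> \<open>\<open>inv_into\<close> recovers the request that an edge serves; edges serving
    none get an arbitrary color, which does no harm.\<close>
  have "omega_good_coloring E ends X (\<lambda>e. snd (inv_into ?I f e))"
    unfolding omega_good_coloring_def
  proof (intro ballI allI)
    fix x k assume "x \<in> X"
    then have "(x, k) \<in> ?I" by simp
    then show "\<exists>e\<in>incident_edges E ends x. snd (inv_into ?I f e) = k"
      using f by (intro bexI[of _ "f (x, k)"]) (auto simp: inv_into_f_f)
  qed
  then show ?thesis by blast
qed

end
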